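(* Let $m\ge1$ and let $k, n_1,\ldots,n_m$ be integers with $n_i \geq k >0$ for all $i \in [m]$. Let $M$ be the complement of a $(k ; n_1, \ldots, n_m)$ circulant block diagonal matrix. Put $d_i = \gcd(n_i,k)$ for every $i \in [m]$, and $n = \sum_{i=1}^{m}{n_i}$. Suppose that there exists an integer $d >1$ that divides $d_i$ for all $i \in [m]$ and that satisfies $\mathrm{rank}_{\mathbb{R}}(M) > \frac{n}{d}$. Then $\mathrm{rank}_{\mathrm{bin}}(M) \geq \mathrm{rank}_{\mathbb{R}}(M) + 1$.
   Context: For integers $n \ge k \ge 0$, $D_{n,k}$ denotes the $n\times n$ circulant $0,1$ matrix whose first row consists of $n-k$ ones followed by $k$ zeros, each subsequent row being the cyclic shift of the previous row by one position to the right. For integers $n_i\ge k\ge 0$, a $(k;n_1,\ldots,n_m)$ circulant block diagonal matrix is a block matrix with $m$ diagonal blocks whose $i$th diagonal block is $D_{n_i,n_i-k}$ (first row: $k$ ones followed by $n_i-k$ zeros) and all of whose other entries are zero. The complement of a $0,1$ matrix is obtained by swapping zeros and ones. The binary rank $\mathrm{rank}_{\mathrm{bin}}(A)$ is the smallest number of combinatorial rectangles (all-one submatrices indexed by a set of rows times a set of columns) that partition the ones of $A$. $\mathrm{rank}_{\mathbb{R}}$ is the rank over the reals. *)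

theory Defs
  imports
    "Jordan_Normal_Form.DL_Rank"
    "HOL-Library.Disjoint_Sets"
begin

(* Rows and columns are indexed from 0; row i is the vector v shifted cyclically
   by i positions to the right. *)
definition circulant_mat :: "'a vec \<Rightarrow> 'a mat" where
  "circulant_mat v =
     mat (dim_vec v) (dim_vec v) (\<lambda>(i, j). v $ ((j + dim_vec v - i) mod dim_vec v))"

definition D_mat :: "nat \<Rightarrow> nat \<Rightarrow> real mat" where
  "D_mat n k = circulant_mat (vec n (\<lambda>j. if j < n - k then 1 else 0))"

definition circulant_block_diag_mat :: "nat \<Rightarrow> nat list \<Rightarrow> real mat" where
  "circulant_block_diag_mat k ns = diag_block_mat (map (\<lambda>n. D_mat n (n - k)) ns)"

definition complement_mat :: "real mat \<Rightarrow> real mat" where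
  "complement_mat A = map_mat (\<lambda>x. 1 - x) A"

definition ones_of :: "real mat \<Rightarrow> (nat \<times> nat) set" where
  "ones_of A = {(i, j). i < dim_row A \<and> j < dim_col A \<and> A $$ (i, j) = 1}"

definition combinatorial_rectangle :: "(nat \<times> nat) set \<Rightarrow> bool" where
  "combinatorial_rectangle S \<longleftrightarrow> (\<exists>R C. S = R \<times> C)"

(* The rectangles are parts of ones_of A, hence within the range of the indices of A
   and all-one. *)
definition rank_bin :: "real mat \<Rightarrow> nat" where
  "rank_bin A = (LEAST r. \<exists>P. finite P \<and> card P = r \<and>
     partition_on (ones_of A) P \<and> (\<forall>S\<in>P. combinatorial_rectangle S))"

definition rank_real :: "real mat \<Rightarrow> nat" where
  "rank_real A = vec_space.rank (dim_row A) A"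

end

theory Submission
  imports Defs
begin

text \<open>
  Write $M = J - B$ with $B$ circulant block diagonal, and suppose that the ones of $M$ are
  partitioned into at most $r = \mathrm{rank}(M)$ rectangles $R_t \times C_t$. Then $M = XY$ is a
  rank factorization, where $X$ and $Y$ consist of the indicator vectors $x_t$ of $R_t$ and $y_t$
  of $C_t$; in particular $y_t \cdot w = 1$ whenever $M w = x_t$. Since $x_t$ and $y_t$ lie in the
  column and row space of $M$, inside block $i$ they meet all residue classes modulo
  $d_i = \gcd(n_i, k)$ equally often. This balance yields a solution $w$ of $M w = x_t$ whose
  denominators are so well controlled that $y_t \cdot w = 1$ forces $d (n - k)$ to divide
  $|R_t| |C_t|$. The areas add up to $n (n - k)$, hence $r d \le n$.
\<close>

section \<open>Rank factorizations\<close>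

lemma mult_mat_zero_vec:
  fixes A :: "'a :: semiring_0 mat"
  assumes "A \<in> carrier_mat nr nc"
  shows "A *\<^sub>v 0\<^sub>v nc = 0\<^sub>v nr"
  using assms by (intro eq_vecI) auto

lemma injective_square_mat_inverse:
  fixes A :: "real mat"
  assumes A: "A \<in> carrier_mat r r"
    and inj: "\<And>z. z \<in> carrier_vec r \<Longrightarrow> A *\<^sub>v z = 0\<^sub>v r \<Longrightarrow> z = 0\<^sub>v r"
  obtains W where "W \<in> carrier_mat r r" "A * W = 1\<^sub>m r"
proof -
  have "det A \<noteq> 0"
    using inj det_0_iff_vec_prod_zero[OF A] by blast
  then have "A \<in> Units (ring_mat TYPE(real) r ())"
    by (rule det_non_zero_imp_unit[OF A])
  then show thesis
    using that by (auto simp: Units_def ring_mat_def)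
qed

text \<open>A maximal independent set of columns has \<open>rank A\<close> elements, and
  \<open>Z\<close> is the 0/1 matrix that selects \<open>r\<close> of them. Writing the selection as
  a factor lets the rank enter later arguments through matrix products alone.\<close>

lemma (in vec_space) independent_column_selection:
  assumes A: "A \<in> carrier_mat n nc" and r: "r \<le> rank A"
  obtains Z where "Z \<in> carrier_mat nc r"
    "\<And>z. z \<in> carrier_vec r \<Longrightarrow> (A * Z) *\<^sub>v z = 0\<^sub>v n \<Longrightarrow> z = 0\<^sub>v r"
proof -
  obtain S where S: "maximal S (\<lambda>T. T \<subseteq> set (cols A) \<and> lin_indpt T)" "finite S"
    using maximal_exists_superset[of "set (cols A)" "\<lambda>T. T \<subseteq> set (cols A) \<and> lin_indpt T" "{}"]
    by (auto simp: lin_dep_def)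
  then have S': "S \<subseteq> set (cols A)" "lin_indpt S" and "rank A = card S"
    using rank_card_indpt[OF A S(1)] by (auto simp: maximal_def)
  with r obtain U where U: "U \<subseteq> S" "card U = r" "finite U"
    by (metis obtain_subset_with_card_n)
  have indU: "lin_indpt U" using S'(2) U(1) subset_li_is_li by blast
  obtain us where us: "set us = U" "distinct us"
    using finite_distinct_list[OF U(3)] by blast
  have len: "length us = r" using us U(2) distinct_card by fastforce
  have "\<exists>j. j < nc \<and> us ! i = col A j" if "i < r" for i
  proof -
    have "us ! i \<in> set (cols A)" using that len us U(1) S'(1) nth_mem by blast
    then show ?thesis using A by (auto simp: in_set_conv_nth)
  qed
  then obtain J where J: "\<And>i. i < r \<Longrightarrow> J i < nc \<and> us ! i = col A (J i)" by metis
  define Z where "Z = mat nc r (\<lambda>(i, j). if i = J j then 1 else 0 :: 'a)"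
  have Z: "Z \<in> carrier_mat nc r" by (simp add: Z_def)
  have colZ: "col (A * Z) i = us ! i" if i: "i < r" for i
  proof -
    have "col Z i = unit_vec nc (J i)"
      using i J[OF i] by (intro eq_vecI) (auto simp: Z_def unit_vec_def)
    moreover have "A *\<^sub>v unit_vec nc (J i) = col A (J i)"
      using A J[OF i] by (intro eq_vecI) auto
    ultimately show ?thesis using col_mult2[OF A Z i] J[OF i] by simp
  qed
  have AZ: "A * Z \<in> carrier_mat n r" using A Z by simp
  have cols: "cols (A * Z) = us"
    using AZ len colZ by (intro nth_equalityI) auto
  have "z = 0\<^sub>v r" if "z \<in> carrier_vec r" "(A * Z) *\<^sub>v z = 0\<^sub>v n" for z
    using lin_depI[OF AZ that(1) _ that(2)] cols us indU by auto
  with Z show thesis using that by blast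
qed

text \<open>Injectivity passes from \<open>X * Y * Z\<close> to the square matrix
  \<open>Y * Z\<close>, whose inverse yields the right inverse \<open>P\<close> of \<open>Y\<close>
  and makes \<open>X\<close> injective. The columns of \<open>P\<close> and \<open>Q\<close> later
  serve as preimages under \<open>X * Y\<close> and its transpose.\<close>

lemma full_rank_factorization:
  fixes X Y :: "real mat"
  assumes X: "X \<in> carrier_mat n r" and Y: "Y \<in> carrier_mat r n'"
    and rank: "r \<le> vec_space.rank n (X * Y)"
  obtains P Q where "P \<in> carrier_mat n' r" "Y * P = 1\<^sub>m r"
    "Q \<in> carrier_mat n r" "X\<^sup>T * Q = 1\<^sub>m r"
    "\<And>z. z \<in> carrier_vec r \<Longrightarrow> X *\<^sub>v z = 0\<^sub>v n \<Longrightarrow> z = 0\<^sub>v r"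
proof -
  have XY: "X * Y \<in> carrier_mat n n'" using X Y by simp
  obtain Z where Z: "Z \<in> carrier_mat n' r"
    and inj: "\<And>z. z \<in> carrier_vec r \<Longrightarrow> (X * Y * Z) *\<^sub>v z = 0\<^sub>v n \<Longrightarrow> z = 0\<^sub>v r"
    using vec_space.independent_column_selection[OF XY rank] by metis
  have XYZ: "(X * Y * Z) *\<^sub>v z = X *\<^sub>v ((Y * Z) *\<^sub>v z)" if "z \<in> carrier_vec r" for z
    using X Y Z that by (simp add: assoc_mult_mat_vec[of X n r "Y * Z" r])
  have YZ: "Y * Z \<in> carrier_mat r r" using Y Z by simp
  have "z = 0\<^sub>v r" if z: "z \<in> carrier_vec r" and "(Y * Z) *\<^sub>v z = 0\<^sub>v r" for z
    using inj[OF z] XYZ[OF z] that mult_mat_zero_vec[OF X] by simp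
  then obtain W where W: "W \<in> carrier_mat r r" "Y * Z * W = 1\<^sub>m r"
    using injective_square_mat_inverse[OF YZ] by metis
  have ZW: "Z * W \<in> carrier_mat n' r" "Y * (Z * W) = 1\<^sub>m r"
    using Y Z W by auto
  have injX: "z = 0\<^sub>v r" if z: "z \<in> carrier_vec r" and "X *\<^sub>v z = 0\<^sub>v n" for z
  proof -
    have Wz: "W *\<^sub>v z \<in> carrier_vec r" using W z by simp
    have "(Y * Z) *\<^sub>v (W *\<^sub>v z) = z"
      using W z YZ by (metis assoc_mult_mat_vec one_mult_mat_vec)
    then have "W *\<^sub>v z = 0\<^sub>v r" using inj[OF Wz] XYZ[OF Wz] that by simp
    then show ?thesis
      using \<open>(Y * Z) *\<^sub>v (W *\<^sub>v z) = z\<close> mult_mat_zero_vec[OF YZ] by simp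
  qed
  \<comment> \<open>A real vector with zero self-product vanishes, so the Gram matrix of the
    injective \<open>X\<close> is injective, hence invertible.\<close>
  have XX: "X\<^sup>T * X \<in> carrier_mat r r" using X by simp
  have "z = 0\<^sub>v r" if z: "z \<in> carrier_vec r" and 0: "(X\<^sup>T * X) *\<^sub>v z = 0\<^sub>v r" for z
  proof -
    have Xz: "X *\<^sub>v z \<in> carrier_vec n" using X z by simp
    have "(X *\<^sub>v z) \<bullet> (X *\<^sub>v z) = (X\<^sup>T *\<^sub>v (X *\<^sub>v z)) \<bullet> z"
      by (rule transpose_vec_mult_scalar[OF X z Xz, symmetric])
    also have "X\<^sup>T *\<^sub>v (X *\<^sub>v z) = 0\<^sub>v r"
      using 0 X z by (simp add: assoc_mult_mat_vec[of _ r n])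
    finally have "(X *\<^sub>v z) \<bullet> (X *\<^sub>v z) = 0" using z by simp
    then have "X *\<^sub>v z = 0\<^sub>v n"
      using Xz conjugate_square_eq_0_vec[OF Xz] by simp
    then show ?thesis using injX z by simp
  qed
  then obtain V where V: "V \<in> carrier_mat r r" "X\<^sup>T * X * V = 1\<^sub>m r"
    using injective_square_mat_inverse[OF XX] by metis
  have "X\<^sup>T * (X * V) = 1\<^sub>m r" "X * V \<in> carrier_mat n r"
    using X V by (auto simp: assoc_mult_mat[of _ r n _ r _ r])
  then show thesis using that ZW injX by blast
qed

lemma rank_mult_le_inner_dim:
  fixes X Y :: "real mat"
  assumes X: "X \<in> carrier_mat n r" and Y: "Y \<in> carrier_mat r n'"
  shows "vec_space.rank n (X * Y) \<le> r"
proof (rule ccontr)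
  assume "\<not> ?thesis"
  then have rank: "Suc r \<le> vec_space.rank n (X * Y)" by simp
  \<comment> \<open>padding with a zero column keeps the product but destroys injectivity\<close>
  define X' where "X' = mat n (Suc r) (\<lambda>(i, t). if t < r then X $$ (i, t) else 0)"
  define Y' where "Y' = mat (Suc r) n' (\<lambda>(t, j). if t < r then Y $$ (t, j) else 0)"
  have X': "X' \<in> carrier_mat n (Suc r)" and Y': "Y' \<in> carrier_mat (Suc r) n'"
    by (simp_all add: X'_def Y'_def)
  have "X' * Y' = X * Y"
    using X Y by (intro eq_matI) (auto simp: X'_def Y'_def scalar_prod_def)
  then have "unit_vec (Suc r) r = (0\<^sub>v (Suc r) :: real vec)"
    if "X' *\<^sub>v unit_vec (Suc r) r = 0\<^sub>v n"
    using full_rank_factorization[OF X' Y'] rank that unit_vec_carrier by metis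
  moreover have "X' *\<^sub>v unit_vec (Suc r) r = 0\<^sub>v n"
    by (intro eq_vecI) (auto simp: X'_def)
  ultimately have "unit_vec (Suc r) r $ r = (0\<^sub>v (Suc r) :: real vec) $ r" by simp
  then show False by simp
qed

section \<open>Integral solutions of cyclic window equations\<close>

lemma periodic_add_mult:
  fixes f :: "nat \<Rightarrow> 'a"
  assumes "\<And>j. f (j + n) = f j"
  shows "f (j + b * n) = f j"
proof (induction b)
  case (Suc b)
  have "f (j + Suc b * n) = f ((j + b * n) + n)" by (simp add: algebra_simps)
  with Suc assms show ?case by metis
qed simp

lemma sum_step_telescope:
  fixes f :: "nat \<Rightarrow> real"
  shows "(\<Sum>l<q. f (j + g + l * g)) - (\<Sum>l<q. f (j + l * g)) = f (j + q * g) - f j"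
  by (induction q) (simp_all add: algebra_simps)

text \<open>The sum runs over a coset of the multiples of \<open>g\<close> modulo \<open>n\<close>.
  A shift by \<open>g\<close> exchanges only its end terms, which agree by periodicity, and
  \<open>k\<close> is a multiple of \<open>g\<close>.\<close>

lemma periodic_coset_sum_shift:
  fixes f :: "nat \<Rightarrow> real"
  assumes per: "\<And>j. f (j + n) = f j" and "g dvd n" "g dvd k"
  shows "(\<Sum>l<n div g. f (j + k + l * g)) = (\<Sum>l<n div g. f (j + l * g))"
proof -
  have 1: "(\<Sum>l<n div g. f (j + g + l * g)) = (\<Sum>l<n div g. f (j + l * g))" for j
    using sum_step_telescope[of f j g "n div g"] per \<open>g dvd n\<close> by simp
  obtain q where q: "k = q * g" using \<open>g dvd k\<close> by (metis dvd_div_mult_self)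
  have "(\<Sum>l<n div g. f (j + q * g + l * g)) = (\<Sum>l<n div g. f (j + l * g))"
  proof (induction q)
    case (Suc q)
    show ?case using 1[of "j + q * g"] Suc by (simp add: algebra_simps)
  qed simp
  then show ?thesis using q by simp
qed

text \<open>For \<open>x\<close> of period \<open>n\<close> and \<open>g\<close> dividing
  \<open>n\<close>, every residue class modulo \<open>g\<close> carries the same share of a period.
  Cyclic vectors are modelled as functions on the naturals, so that windows need no
  wraparound.\<close>

definition balanced :: "nat \<Rightarrow> nat \<Rightarrow> (nat \<Rightarrow> real) \<Rightarrow> bool" where
  "balanced n g x \<longleftrightarrow>
     (\<forall>j. (\<Sum>l<n div g. x (j + l * g)) = (\<Sum>l<n div g. x (l * g)))"

lemma window_sum_Suc:
  fixes f :: "nat \<Rightarrow> real"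
  shows "(\<Sum>i<k. f (Suc j + i)) - (\<Sum>i<k. f (j + i)) = f (j + k) - f j"
  by (induction k) (simp_all add: algebra_simps)

text \<open>Moving the window by one place drops \<open>v j\<close> and adds
  \<open>v (j + k)\<close>. Both positions lie in the same class modulo \<open>g\<close>, so these
  changes cancel when summed over a class.\<close>

lemma balanced_window_sum:
  assumes per: "\<And>j. v (j + n) = v j" and "g dvd n" "g dvd k"
    and x: "\<And>j. x j = s - (\<Sum>i<k. v (j + i))"
  shows "balanced n g x"
proof -
  have "(\<Sum>l<n div g. x (Suc j + l * g)) = (\<Sum>l<n div g. x (j + l * g))" for j
  proof -
    have "x (Suc j + l * g) = x (j + l * g) - (v (j + k + l * g) - v (j + l * g))" for l
      using window_sum_Suc[of v "j + l * g" k] by (simp add: x algebra_simps)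
    then show ?thesis
      using periodic_coset_sum_shift[of v n g k j, OF per] assms(2,3)
      by (simp add: sum_subtractf)
  qed
  then have "(\<Sum>l<n div g. x (j + l * g)) = (\<Sum>l<n div g. x (0 + l * g))" for j
    by (induction j) (simp_all del: add_Suc)
  then show ?thesis by (simp add: balanced_def)
qed

text \<open>For integral \<open>y\<close> this makes the total over a period a multiple of
  \<open>g\<close>; that divisibility later cancels the denominator \<open>d\<close>.\<close>

lemma balanced_sum:
  assumes bal: "balanced n g y" and "g dvd n" "g > 0"
  shows "(\<Sum>j<n. y j) = real g * (\<Sum>l<n div g. y (l * g))"
proof -
  have "(\<Sum>j<q * g. y j) = (\<Sum>l<q. \<Sum>i<g. y (i + l * g))" for q
    using sum.nat_group[of y g q] sum.shift_bounds_nat_ivl[of y 0 "_ * g" g]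
    by (simp add: atLeast0LessThan add.commute)
  then have "(\<Sum>j<n. y j) = (\<Sum>l<n div g. \<Sum>i<g. y (i + l * g))"
    using \<open>g dvd n\<close> by (metis dvd_div_mult_self)
  also have "\<dots> = (\<Sum>i<g. \<Sum>l<n div g. y (i + l * g))"
    by (rule sum.swap)
  also have "\<dots> = (\<Sum>i<g. \<Sum>l<n div g. y (l * g))"
    using bal by (simp add: balanced_def)
  finally show ?thesis by simp
qed

text \<open>Differencing in \<open>j\<close> reduces the window equation to
  \<open>w (j + k) - w j = x (Suc j) - x j\<close>. Balance gives this an integral periodic
  solution, and differencing loses only the constant \<open>c\<close>.\<close>

lemma integral_window_solution:
  assumes per: "\<And>j. x (j + n) = x j" and int: "\<And>j. x j \<in> \<int>"
    and "n > 0" "k > 0" and bal: "balanced n (gcd k n) x"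
  obtains w c where "\<And>j. w (j + n) = w j" "\<And>j. w j \<in> \<int>" "c \<in> \<int>"
    "\<And>j. (\<Sum>i<k. w (j + i)) = x j + c"
proof -
  define g where "g = gcd k n"
  have g: "g > 0" "g dvd n" "g dvd k" using \<open>n > 0\<close> by (auto simp: g_def)
  define h where "h j = x (Suc j) - x j" for j
  \<comment> \<open>solves the equation for windows of length \<open>g\<close>; Bezout then turns length \<open>g\<close> into length \<open>k\<close>\<close>
  define v where "v j = (\<Sum>l<j div g. h (j mod g + l * g))" for j
  have v_g: "v (j + g) = v j + h j" for j
    using g(1) by (simp add: v_def div_add_self2)
  have v_mult: "v (j + q * g) = v j + (\<Sum>l<q. h (j + l * g))" for j q
  proof (induction q)
    case (Suc q)
    have "v (j + Suc q * g) = v (j + q * g) + h (j + q * g)"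
      using v_g[of "j + q * g"] by (simp add: algebra_simps)
    then show ?case using Suc by simp
  qed simp
  have v_per: "v (j + n) = v j" for j
  proof -
    \<comment> \<open>The increments \<open>h\<close> along one residue class add up to the
      difference of two adjacent class sums of \<open>x\<close>, which balance makes zero.\<close>
    have "(\<Sum>l<n div g. h (j + l * g)) = 0"
      using bal[unfolded balanced_def, rule_format, of "Suc j"]
        bal[unfolded balanced_def, rule_format, of j]
      by (simp add: h_def sum_subtractf g_def)
    then show ?thesis using v_mult[of j "n div g"] g by simp
  qed
  obtain a b where ab: "k * a = n * b + g"
    using bezout_nat[of k n] \<open>k > 0\<close> by (auto simp: g_def)
  \<comment> \<open>Along steps of length \<open>k\<close> the increment of this sum telescopes to
    \<open>v (j + a * k) - v j\<close>, and \<open>a * k\<close> is congruent to \<open>g\<close>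
    modulo \<open>n\<close>.\<close>
  define w where "w j = (\<Sum>s<a. v (j + s * k))" for j
  have w_per: "w (j + n) = w j" for j
    using v_per[of "j + _ * k"] by (simp add: w_def add.assoc add.commute[of n])
  have v_int: "v j \<in> \<int>" for j
    using int by (auto simp: v_def h_def intro!: Ints_sum)
  have w_int: "w j \<in> \<int>" for j
    using v_int by (auto simp: w_def intro!: Ints_sum)
  have w_step: "w (j + k) - w j = x (Suc j) - x j" for j
  proof -
    have "w (j + k) - w j = v (j + a * k) - v j"
      using sum_step_telescope[of v j k a] by (simp add: w_def)
    also have "j + a * k = (j + g) + b * n" using ab by (simp add: algebra_simps)
    also have "v \<dots> = v (j + g)" using periodic_add_mult[of v n, OF v_per] .
    finally show ?thesis using v_g by (simp add: h_def)
  qed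
  define c where "c = (\<Sum>i<k. w i) - x 0"
  have "(\<Sum>i<k. w (j + i)) = x j + c" for j
  proof (induction j)
    case (Suc j)
    then show ?case using window_sum_Suc[of w j k] w_step[of j] by simp
  qed (simp add: c_def)
  moreover have "c \<in> \<int>" using int w_int by (auto simp: c_def intro!: Ints_sum Ints_diff)
  ultimately show thesis using that w_per w_int by blast
qed

section \<open>Circulant blocks\<close>

lemma D_mat_carrier [simp]: "D_mat n k \<in> carrier_mat n n"
  by (simp add: D_mat_def circulant_mat_def)

lemma D_mat_dim [simp]: "dim_row (D_mat n k) = n" "dim_col (D_mat n k) = n"
  by (simp_all add: D_mat_def circulant_mat_def)

lemma D_mat_index:
  assumes "k \<le> n" "i < n" "j < n"
  shows "D_mat n (n - k) $$ (i, j) = (if (j + n - i) mod n < k then 1 else 0)"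
  using assms by (simp add: D_mat_def circulant_mat_def)

lemma sum_D_mat_row:
  assumes "k \<le> n" "i < n"
  shows "(\<Sum>j<n. D_mat n (n - k) $$ (i, j) * f j) = (\<Sum>s<k. f ((i + s) mod n))"
proof -
  have inv1: "((i + s) mod n + n - i) mod n = s" if "s < n" for s
    using assms(2) that by (cases "i + s < n") (auto simp: mod_if)
  have inv2: "(i + (j + n - i) mod n) mod n = j" if "j < n" for j
    using assms(2) that by (cases "i \<le> j") (auto simp: mod_if)
  have "(\<Sum>j<n. D_mat n (n - k) $$ (i, j) * f j)
      = (\<Sum>j<n. if (j + n - i) mod n < k then f j else 0)"
    using assms by (intro sum.cong) (auto simp: D_mat_index)
  also have "\<dots> = (\<Sum>j | j < n \<and> (j + n - i) mod n < k. f j)"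
    by (subst sum.inter_filter[symmetric]) auto
  also have "\<dots> = (\<Sum>s<k. f ((i + s) mod n))"
    using assms inv1 inv2
    by (intro sum.reindex_bij_witness[of _ "\<lambda>s. (i + s) mod n" "\<lambda>j. (j + n - i) mod n"]) auto
  finally show ?thesis .
qed

text \<open>Column \<open>j\<close> has its ones in the rows \<open>j - k + 1\<close> to
  \<open>j\<close>, cyclically. The offset \<open>n - k + 1\<close> expresses the start of this
  window without negative numbers.\<close>

lemma sum_D_mat_col:
  assumes "k \<le> n" "j < n"
  shows "(\<Sum>i<n. D_mat n (n - k) $$ (i, j) * f i) = (\<Sum>s<k. f ((j + (n - k + 1) + s) mod n))"
proof -
  have inv1: "(j + n - (j + n - s) mod n) mod n = s" if "s < n" for s
    using assms(2) that by (cases "s \<le> j") (auto simp: mod_if)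
  have inv2: "(j + n - (j + n - i) mod n) mod n = i" if "i < n" for i
    using assms(2) that by (cases "i \<le> j") (auto simp: mod_if)
  have "(\<Sum>i<n. D_mat n (n - k) $$ (i, j) * f i)
      = (\<Sum>i<n. if (j + n - i) mod n < k then f i else 0)"
    using assms by (intro sum.cong) (auto simp: D_mat_index)
  also have "\<dots> = (\<Sum>i | i < n \<and> (j + n - i) mod n < k. f i)"
    by (subst sum.inter_filter[symmetric]) auto
  also have "\<dots> = (\<Sum>s<k. f ((j + n - s) mod n))"
    using assms inv1 inv2
    by (intro sum.reindex_bij_witness[of _ "\<lambda>s. (j + n - s) mod n" "\<lambda>i. (j + n - i) mod n"]) auto
  \<comment> \<open>Reversing the summation turns the window descending from \<open>j\<close> into
    one ascending to \<open>j\<close>.\<close>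
  also have "\<dots> = (\<Sum>s<k. f ((j + n - (k - Suc s)) mod n))"
    by (rule sum.nat_diff_reindex[symmetric])
  also have "\<dots> = (\<Sum>s<k. f ((j + (n - k + 1) + s) mod n))"
  proof (rule sum.cong)
    fix s assume "s \<in> {..<k}"
    then have "j + n - (k - Suc s) = j + (n - k + 1) + s" using assms by auto
    then show "f ((j + n - (k - Suc s)) mod n) = f ((j + (n - k + 1) + s) mod n)" by simp
  qed simp
  finally show ?thesis .
qed

lemma D_mat_mult_vec:
  assumes "k \<le> n" "i < n" "v \<in> carrier_vec n"
  shows "(D_mat n (n - k) *\<^sub>v v) $ i = (\<Sum>s<k. v $ ((i + s) mod n))"
  using sum_D_mat_row[OF assms(1,2), of "\<lambda>j. v $ j"] assms
  by (simp add: scalar_prod_def atLeast0LessThan)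

lemma D_mat_transpose_mult_vec:
  assumes "k \<le> n" "j < n" "v \<in> carrier_vec n"
  shows "((D_mat n (n - k))\<^sup>T *\<^sub>v v) $ j = (\<Sum>s<k. v $ ((j + (n - k + 1) + s) mod n))"
  using sum_D_mat_col[OF assms(1,2), of "\<lambda>j. v $ j"] assms
  by (simp add: scalar_prod_def atLeast0LessThan)

abbreviation ones_vec :: "nat \<Rightarrow> real vec" where
  "ones_vec n \<equiv> vec n (\<lambda>_. 1)"

definition int_vec :: "real vec \<Rightarrow> bool" where
  "int_vec x \<longleftrightarrow> (\<forall>i<dim_vec x. x $ i \<in> \<int>)"

text \<open>The assumed forms of \<open>x\<close> and \<open>y\<close> are what one block of a
  vector in the column or row space of the complement looks like, and they force balance modulo
  \<open>gcd k n\<close>. So \<open>x\<close> has a solution that is integral up to a constant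
  vector, and pairing that constant with the balanced \<open>y\<close> gains a factor
  \<open>gcd k n\<close>.\<close>

lemma D_mat_integral_pairing:
  fixes x y u v :: "real vec"
  assumes k: "0 < k" "k \<le> n" and d: "d dvd n" "d dvd k"
    and x: "x \<in> carrier_vec n" "int_vec x"
    and y: "y \<in> carrier_vec n" "int_vec y"
    and v: "v \<in> carrier_vec n" "x = s \<cdot>\<^sub>v ones_vec n - D_mat n (n - k) *\<^sub>v v"
    and u: "u \<in> carrier_vec n" "y = t \<cdot>\<^sub>v ones_vec n - (D_mat n (n - k))\<^sup>T *\<^sub>v u"
  obtains w where "w \<in> carrier_vec n" "D_mat n (n - k) *\<^sub>v w = x"
    "real k / real d * (y \<bullet> w) \<in> \<int>"
proof -
  define g where "g = gcd k n"
  have n: "n > 0" using k by simp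
  have g: "g dvd n" "g dvd k" "g > 0" using n by (auto simp: g_def)
  have dg: "d dvd g" using d by (simp add: g_def)
  have d0: "d > 0" using d n by (auto intro: Nat.gr0I)
  define x' where "x' j = x $ (j mod n)" for j
  define y' where "y' j = y $ (j mod n)" for j
  have carr: "D_mat n (n - k) *\<^sub>v v \<in> carrier_vec n" "(D_mat n (n - k))\<^sup>T *\<^sub>v u \<in> carrier_vec n"
    using v(1) u(1) by (auto intro!: mult_mat_vec_carrier[of _ n n])
  have x'_eq: "x' j = s - (\<Sum>i<k. v $ ((j + i) mod n))" for j
  proof -
    have "j mod n < n" using n by simp
    then show ?thesis
      using carr D_mat_mult_vec[OF k(2) _ v(1), of "j mod n"] v(2)
      by (simp add: x'_def mod_add_left_eq del: index_mult_mat_vec)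
  qed
  have y'_eq: "y' j = t - (\<Sum>i<k. u $ ((j + i + (n - k + 1)) mod n))" for j
  proof -
    have "j mod n < n" using n by simp
    then have "y' j = t - (\<Sum>i<k. u $ ((j mod n + (n - k + 1) + i) mod n))"
      using carr D_mat_transpose_mult_vec[OF k(2) _ u(1), of "j mod n"] u(2)
      by (simp add: y'_def del: index_mult_mat_vec)
    moreover have "(j mod n + (n - k + 1) + i) mod n = (j + i + (n - k + 1)) mod n" for i
      using mod_add_left_eq[of j n "i + (n - k + 1)"] by (simp only: ac_simps)
    ultimately show ?thesis by simp
  qed
  have xbal: "balanced n g x'"
    by (rule balanced_window_sum[where v = "\<lambda>j. v $ (j mod n)", OF _ g(1,2) x'_eq]) simp
  have per: "(j + n + (n - k + 1)) mod n = (j + (n - k + 1)) mod n" for j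
    using mod_add_self2[of "j + (n - k + 1)" n] by (simp only: ac_simps)
  \<comment> \<open>Column windows start at offset \<open>n - k + 1\<close>, so \<open>y'\<close>
    comes from the windows of \<open>u\<close> shifted by that offset.\<close>
  have ybal: "balanced n g y'"
    by (rule balanced_window_sum[where v = "\<lambda>j. u $ ((j + (n - k + 1)) mod n)", OF _ g(1,2) y'_eq])
      (simp only: per)
  have xint: "x' j \<in> \<int>" and yint: "y' j \<in> \<int>" for j
    using x y n by (auto simp: x'_def y'_def int_vec_def)
  obtain w0 c where w0: "\<And>j. w0 (j + n) = w0 j" "\<And>j. w0 j \<in> \<int>" "c \<in> \<int>"
    "\<And>j. (\<Sum>i<k. w0 (j + i)) = x' j + c"
    using integral_window_solution[of x' n k] xint xbal k(1) n by (metis g_def mod_add_self2 x'_def)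
  \<comment> \<open>Each window has \<open>k\<close> entries, so subtracting
    \<open>c / real k\<close> from every entry removes the surplus \<open>c\<close>. This constant
    is the only possibly non-integral part of \<open>w\<close>.\<close>
  define w where "w = vec n (\<lambda>j. w0 j - c / real k)"
  have w: "w \<in> carrier_vec n" by (simp add: w_def)
  have w0_mod: "w0 (j mod n) = w0 j" for j
    using periodic_add_mult[of w0 n "j mod n" "j div n", OF w0(1)] by simp
  have "D_mat n (n - k) *\<^sub>v w = x"
  proof (rule eq_vecI)
    fix i assume "i < dim_vec x"
    then have i: "i < n" using x by simp
    have "(D_mat n (n - k) *\<^sub>v w) $ i = (\<Sum>s<k. w $ ((i + s) mod n))"
      by (rule D_mat_mult_vec[OF k(2) i w])
    also have "\<dots> = (\<Sum>s<k. w0 (i + s) - c / real k)"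
      using n by (simp add: w_def w0_mod)
    also have "\<dots> = x $ i"
      using k i by (simp add: sum_subtractf w0(4) x'_def)
    finally show "(D_mat n (n - k) *\<^sub>v w) $ i = x $ i" .
  qed (use x in simp)
  moreover have "real k / real d * (y \<bullet> w) \<in> \<int>"
  proof -
    obtain e where e: "g = d * e" using dg by blast
    obtain f where f: "k = d * f" using d by blast
    have "y \<bullet> w = (\<Sum>j<n. y' j * (w0 j - c / real k))"
      by (simp add: scalar_prod_def w_def y'_def atLeast0LessThan)
    also have "\<dots> = (\<Sum>j<n. y' j * w0 j) - c / real k * (\<Sum>j<n. y' j)"
      by (simp add: right_diff_distrib sum_subtractf sum_distrib_left sum_divide_distrib mult.commute)
    also have "(\<Sum>j<n. y' j) = real g * (\<Sum>l<n div g. y' (l * g))"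
      by (rule balanced_sum[OF ybal g(1,3)])
    \<comment> \<open>The factor \<open>k\<close> cancels the denominator of
      \<open>c / real k\<close>, while the factor \<open>g = d * e\<close> of the total of
      \<open>y\<close> cancels \<open>d\<close>.\<close>
    finally have "real k / real d * (y \<bullet> w)
        = real f * (\<Sum>j<n. y' j * w0 j) - c * real e * (\<Sum>l<n div g. y' (l * g))"
      using k d0 by (simp add: e f field_simps)
    also have "\<dots> \<in> \<int>"
      using yint w0 by (intro Ints_diff Ints_mult Ints_sum) auto
    finally show ?thesis .
  qed
  ultimately show thesis using that w by blast
qed

section \<open>Block diagonal matrices\<close>

lemma circulant_block_diag_carrier:
  "circulant_block_diag_mat k ns \<in> carrier_mat (sum_list ns) (sum_list ns)"
  by (rule carrier_matI)
    (simp_all add: circulant_block_diag_mat_def dim_diag_block_mat o_def)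

lemma circulant_block_diag_Cons:
  "circulant_block_diag_mat k (n # ns) =
     four_block_mat (D_mat n (n - k)) (0\<^sub>m n (sum_list ns)) (0\<^sub>m (sum_list ns) n)
       (circulant_block_diag_mat k ns)"
  using carrier_matD[OF circulant_block_diag_carrier[of k ns]]
  by (simp add: circulant_block_diag_mat_def Let_def)

lemma circulant_block_diag_Cons_mult:
  assumes "a \<in> carrier_vec n" "b \<in> carrier_vec (sum_list ns)"
  shows "circulant_block_diag_mat k (n # ns) *\<^sub>v (a @\<^sub>v b) =
      (D_mat n (n - k) *\<^sub>v a) @\<^sub>v (circulant_block_diag_mat k ns *\<^sub>v b)"
    and "(circulant_block_diag_mat k (n # ns))\<^sup>T *\<^sub>v (a @\<^sub>v b) =
      ((D_mat n (n - k))\<^sup>T *\<^sub>v a) @\<^sub>v ((circulant_block_diag_mat k ns)\<^sup>T *\<^sub>v b)"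
proof -
  note B = circulant_block_diag_carrier[of k ns]
  show "circulant_block_diag_mat k (n # ns) *\<^sub>v (a @\<^sub>v b) =
      (D_mat n (n - k) *\<^sub>v a) @\<^sub>v (circulant_block_diag_mat k ns *\<^sub>v b)"
    unfolding circulant_block_diag_Cons
    by (rule mult_mat_vec_split[OF D_mat_carrier B assms])
  have "(circulant_block_diag_mat k (n # ns))\<^sup>T =
      four_block_mat (D_mat n (n - k))\<^sup>T (0\<^sub>m n (sum_list ns)) (0\<^sub>m (sum_list ns) n)
        (circulant_block_diag_mat k ns)\<^sup>T"
    unfolding circulant_block_diag_Cons
    by (subst transpose_four_block_mat[OF D_mat_carrier _ _ B]) auto
  then show "(circulant_block_diag_mat k (n # ns))\<^sup>T *\<^sub>v (a @\<^sub>v b) =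
      ((D_mat n (n - k))\<^sup>T *\<^sub>v a) @\<^sub>v ((circulant_block_diag_mat k ns)\<^sup>T *\<^sub>v b)"
    using mult_mat_vec_split[of "(D_mat n (n - k))\<^sup>T" n "(circulant_block_diag_mat k ns)\<^sup>T"] B assms
    by simp
qed

lemma smult_ones_minus_append:
  assumes "a \<in> carrier_vec n" "b \<in> carrier_vec n'"
  shows "s \<cdot>\<^sub>v ones_vec (n + n') - (a @\<^sub>v b) =
    (s \<cdot>\<^sub>v ones_vec n - a) @\<^sub>v (s \<cdot>\<^sub>v ones_vec n' - b)"
  using assms by (intro eq_vecI) auto

lemma int_vec_append [simp]: "int_vec (a @\<^sub>v b) \<longleftrightarrow> int_vec a \<and> int_vec b"
proof
  assume ab: "int_vec (a @\<^sub>v b)"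
  have "a $ i \<in> \<int>" if "i < dim_vec a" for i
    using ab that by (auto simp: int_vec_def dest: spec[of _ i])
  moreover have "b $ i \<in> \<int>" if "i < dim_vec b" for i
    using ab that by (auto simp: int_vec_def dest: spec[of _ "dim_vec a + i"])
  ultimately show "int_vec a \<and> int_vec b" by (simp add: int_vec_def)
qed (auto simp: int_vec_def)

lemma split_vec:
  assumes "x \<in> carrier_vec (n + n')"
  obtains a b where "a \<in> carrier_vec n" "b \<in> carrier_vec n'" "x = a @\<^sub>v b"
  using assms vec_first_last_append[OF assms] vec_first_carrier vec_last_carrier by metis

text \<open>The scalars \<open>s\<close> and \<open>t\<close> and the factor \<open>k / d\<close>
  are common to all blocks. Hence the hypotheses split along the blocks, and the integral pairings
  of the blocks add up.\<close>

lemma circulant_block_diag_integral_pairing: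
  fixes x y u v :: "real vec"
  assumes "0 < k" "d dvd k" and "\<forall>n\<in>set ns. k \<le> n \<and> d dvd n"
    and "N = sum_list ns" "B = circulant_block_diag_mat k ns"
    and "x \<in> carrier_vec N" "int_vec x"
    and "y \<in> carrier_vec N" "int_vec y"
    and "v \<in> carrier_vec N" "x = s \<cdot>\<^sub>v ones_vec N - B *\<^sub>v v"
    and "u \<in> carrier_vec N" "y = t \<cdot>\<^sub>v ones_vec N - B\<^sup>T *\<^sub>v u"
  shows "\<exists>w \<in> carrier_vec N. B *\<^sub>v w = x \<and> real k / real d * (y \<bullet> w) \<in> \<int>"
  using assms
proof (induction ns arbitrary: x y u v N B)
  case Nil
  then have "B \<in> carrier_mat 0 0" using circulant_block_diag_carrier[of k "[]"] by simp
  with Nil show ?case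
    by (intro bexI[of _ "0\<^sub>v 0"]) (auto simp: scalar_prod_def)
next
  case (Cons n ns)
  let ?N = "sum_list ns" and ?D = "D_mat n (n - k)" and ?B = "circulant_block_diag_mat k ns"
  have N: "N = n + ?N" using Cons.prems by simp
  obtain x1 x2 where x: "x1 \<in> carrier_vec n" "x2 \<in> carrier_vec ?N" "x = x1 @\<^sub>v x2"
    using split_vec Cons.prems(6) N by metis
  obtain y1 y2 where y: "y1 \<in> carrier_vec n" "y2 \<in> carrier_vec ?N" "y = y1 @\<^sub>v y2"
    using split_vec Cons.prems(8) N by metis
  obtain v1 v2 where v: "v1 \<in> carrier_vec n" "v2 \<in> carrier_vec ?N" "v = v1 @\<^sub>v v2"
    using split_vec Cons.prems(10) N by metis
  obtain u1 u2 where u: "u1 \<in> carrier_vec n" "u2 \<in> carrier_vec ?N" "u = u1 @\<^sub>v u2"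
    using split_vec Cons.prems(12) N by metis
  note Bc = circulant_block_diag_carrier[of k ns]
  have carr: "?D *\<^sub>v v1 \<in> carrier_vec n" "?B *\<^sub>v v2 \<in> carrier_vec ?N"
    "?D\<^sup>T *\<^sub>v u1 \<in> carrier_vec n" "?B\<^sup>T *\<^sub>v u2 \<in> carrier_vec ?N"
    using v u Bc by (auto intro!: carrier_vecI)
  have "x1 @\<^sub>v x2 = (s \<cdot>\<^sub>v ones_vec n - ?D *\<^sub>v v1) @\<^sub>v (s \<cdot>\<^sub>v ones_vec ?N - ?B *\<^sub>v v2)"
    using Cons.prems(11) x(3) circulant_block_diag_Cons_mult(1)[OF v(1,2), of k]
      smult_ones_minus_append[OF carr(1,2)] by (simp add: v(3) N Cons.prems(5))
  then have x_eq: "x1 = s \<cdot>\<^sub>v ones_vec n - ?D *\<^sub>v v1" "x2 = s \<cdot>\<^sub>v ones_vec ?N - ?B *\<^sub>v v2"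
    using append_vec_eq[of x1 n "s \<cdot>\<^sub>v ones_vec n - ?D *\<^sub>v v1"] x(1) carr(1) by simp_all
  have "y1 @\<^sub>v y2 = (t \<cdot>\<^sub>v ones_vec n - ?D\<^sup>T *\<^sub>v u1) @\<^sub>v (t \<cdot>\<^sub>v ones_vec ?N - ?B\<^sup>T *\<^sub>v u2)"
    using Cons.prems(13) y(3) circulant_block_diag_Cons_mult(2)[OF u(1,2), of k]
      smult_ones_minus_append[OF carr(3,4)] by (simp add: u(3) N Cons.prems(5))
  then have y_eq: "y1 = t \<cdot>\<^sub>v ones_vec n - ?D\<^sup>T *\<^sub>v u1" "y2 = t \<cdot>\<^sub>v ones_vec ?N - ?B\<^sup>T *\<^sub>v u2"
    using append_vec_eq[of y1 n "t \<cdot>\<^sub>v ones_vec n - ?D\<^sup>T *\<^sub>v u1"] y(1) carr(3) by simp_all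
  have int: "int_vec x1" "int_vec x2" "int_vec y1" "int_vec y2"
    using Cons.prems(7,9) x(3) y(3) by auto
  have kn: "k \<le> n" "d dvd n" using Cons.prems(3) by auto
  obtain w1 where w1: "w1 \<in> carrier_vec n" "?D *\<^sub>v w1 = x1" "real k / real d * (y1 \<bullet> w1) \<in> \<int>"
    using D_mat_integral_pairing[OF Cons.prems(1) kn Cons.prems(2) x(1) int(1) y(1) int(3)
        v(1) x_eq(1) u(1) y_eq(1)] by metis
  obtain w2 where w2: "w2 \<in> carrier_vec ?N" "?B *\<^sub>v w2 = x2" "real k / real d * (y2 \<bullet> w2) \<in> \<int>"
    using Cons.IH[OF Cons.prems(1,2) _ refl refl x(2) int(2) y(2) int(4) v(2) x_eq(2) u(2) y_eq(2)]
      Cons.prems(3) by auto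
  have "B *\<^sub>v (w1 @\<^sub>v w2) = x"
    using circulant_block_diag_Cons_mult(1)[OF w1(1) w2(1), of k] Cons.prems(5) w1(2) w2(2) x(3)
    by simp
  moreover have "real k / real d * (y \<bullet> (w1 @\<^sub>v w2)) \<in> \<int>"
    using Ints_add[OF w1(3) w2(3)] scalar_prod_append[OF y(1,2) w1(1) w2(1)] y(3)
    by (simp add: distrib_left)
  ultimately show ?case
    using w1(1) w2(1) N by (intro bexI[of _ "w1 @\<^sub>v w2"]) auto
qed

lemma circulant_block_diag_ones:
  assumes "\<forall>n\<in>set ns. k \<le> n"
  shows "circulant_block_diag_mat k ns *\<^sub>v ones_vec (sum_list ns)
      = real k \<cdot>\<^sub>v ones_vec (sum_list ns) \<and>
    (circulant_block_diag_mat k ns)\<^sup>T *\<^sub>v ones_vec (sum_list ns)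
      = real k \<cdot>\<^sub>v ones_vec (sum_list ns)"
  using assms
proof (induction ns)
  case Nil
  show ?case using carrier_matD[OF circulant_block_diag_carrier[of k "[]"]]
    by (auto intro!: eq_vecI)
next
  case (Cons n ns)
  have app: "ones_vec (n + sum_list ns) = ones_vec n @\<^sub>v ones_vec (sum_list ns)"
    "real k \<cdot>\<^sub>v (ones_vec n @\<^sub>v ones_vec (sum_list ns))
      = (real k \<cdot>\<^sub>v ones_vec n) @\<^sub>v (real k \<cdot>\<^sub>v ones_vec (sum_list ns))"
    by (auto intro!: eq_vecI)
  have k: "k \<le> n" using Cons.prems by simp
  have D: "D_mat n (n - k) *\<^sub>v ones_vec n = real k \<cdot>\<^sub>v ones_vec n"
    using D_mat_mult_vec[OF k, of _ "ones_vec n"]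
    by (intro eq_vecI) (auto simp del: index_mult_mat_vec)
  have DT: "(D_mat n (n - k))\<^sup>T *\<^sub>v ones_vec n = real k \<cdot>\<^sub>v ones_vec n"
    using D_mat_transpose_mult_vec[OF k, of _ "ones_vec n"]
    by (intro eq_vecI) (auto simp del: index_mult_mat_vec)
  show ?case
    using Cons circulant_block_diag_Cons_mult[of "ones_vec n" n "ones_vec (sum_list ns)" ns k] D DT
    by (simp add: app)
qed

lemma circulant_block_diag_01:
  assumes "\<forall>n\<in>set ns. k \<le> n" "i < sum_list ns" "j < sum_list ns"
  shows "circulant_block_diag_mat k ns $$ (i, j) \<in> {0, 1}"
  using assms
proof (induction ns arbitrary: i j)
  case (Cons n ns)
  then show ?case
    using carrier_matD[OF circulant_block_diag_carrier[of k ns]]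
    by (auto simp: circulant_block_diag_Cons D_mat_index)
qed simp

section \<open>Rectangle partitions\<close>

lemma complement_mat_carrier [simp]:
  "A \<in> carrier_mat nr nc \<Longrightarrow> complement_mat A \<in> carrier_mat nr nc"
  by (simp add: complement_mat_def)

lemma complement_mat_mult_vec:
  assumes "A \<in> carrier_mat nr nc" "w \<in> carrier_vec nc"
  shows "complement_mat A *\<^sub>v w = (ones_vec nc \<bullet> w) \<cdot>\<^sub>v ones_vec nr - A *\<^sub>v w"
  using assms
  by (intro eq_vecI)
    (auto simp: complement_mat_def scalar_prod_def left_diff_distrib sum_subtractf)

lemma complement_mat_transpose: "(complement_mat A)\<^sup>T = complement_mat A\<^sup>T"
  by (auto simp: complement_mat_def intro!: eq_matI)

text \<open>Any solution \<open>w\<close> of \<open>M w = x\<close> pairs to 1 with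
  \<open>y\<close>, because the factorization is tight. Evaluating this pairing on a solution with
  controlled denominators turns the equation into a divisibility statement about the area of the
  rectangle.\<close>

lemma tight_factor_integrality:
  fixes X Y :: "real mat"
  assumes k: "0 < k" "d dvd k" and ns: "\<forall>n\<in>set ns. k \<le> n \<and> d dvd n"
    and N: "N = sum_list ns" "k < N"
    and M: "M = complement_mat (circulant_block_diag_mat k ns)" "M = X * Y"
    and X: "X \<in> carrier_mat N r" and Y: "Y \<in> carrier_mat r N"
    and rank: "r \<le> vec_space.rank N M"
    and t: "t < r" and int: "int_vec (col X t)" "int_vec (row Y t)"
  shows "(ones_vec N \<bullet> col X t) * (ones_vec N \<bullet> row Y t) / (real d * real (N - k)) \<in> \<int>"
proof -
  define B where "B = circulant_block_diag_mat k ns"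
  define x where "x = col X t"
  define y where "y = row Y t"
  have B: "B \<in> carrier_mat N N" using N circulant_block_diag_carrier by (simp add: B_def)
  have BT: "B\<^sup>T \<in> carrier_mat N N" using B by simp
  have x: "x \<in> carrier_vec N" and y: "y \<in> carrier_vec N"
    using X Y t by (auto simp: x_def y_def)
  obtain P Q where P: "P \<in> carrier_mat N r" "Y * P = 1\<^sub>m r"
    and Q: "Q \<in> carrier_mat N r" "X\<^sup>T * Q = 1\<^sub>m r"
    and injX: "\<And>z. z \<in> carrier_vec r \<Longrightarrow> X *\<^sub>v z = 0\<^sub>v N \<Longrightarrow> z = 0\<^sub>v r"
    using full_rank_factorization[OF X Y] rank M(2) by metis
  have v: "col P t \<in> carrier_vec N" and u: "col Q t \<in> carrier_vec N"
    using P Q t by auto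
  \<comment> \<open>The columns of \<open>P\<close> are preimages of the columns of \<open>X\<close>
    under \<open>M\<close>, and below those of \<open>Q\<close> play the same role for the
    transpose. This puts \<open>x\<close> and \<open>y\<close> into the form that the pairing lemma
    requires.\<close>
  have "X * Y * P = X" using X Y P by (simp add: assoc_mult_mat[of X N r Y N P r])
  then have "M *\<^sub>v col P t = x"
    using col_mult2[of "X * Y" N N P r t] X Y P t M(2) by (simp add: x_def)
  then have x_eq: "x = (ones_vec N \<bullet> col P t) \<cdot>\<^sub>v ones_vec N - B *\<^sub>v col P t"
    using complement_mat_mult_vec[OF B v] M(1) by (simp add: B_def)
  have "M\<^sup>T = Y\<^sup>T * X\<^sup>T" using transpose_mult[OF X Y] M(2) by simp
  then have "M\<^sup>T * Q = Y\<^sup>T"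
    using X Y Q by (simp add: assoc_mult_mat[of "Y\<^sup>T" N r "X\<^sup>T" N Q r])
  moreover have "M\<^sup>T \<in> carrier_mat N N" using M(2) X Y by simp
  ultimately have "M\<^sup>T *\<^sub>v col Q t = y"
    using col_mult2[of "M\<^sup>T" N N Q r t] Q t Y by (simp add: y_def)
  then have y_eq: "y = (ones_vec N \<bullet> col Q t) \<cdot>\<^sub>v ones_vec N - B\<^sup>T *\<^sub>v col Q t"
    using complement_mat_mult_vec[OF BT u] M(1) by (simp add: B_def complement_mat_transpose)
  obtain w1 where w1: "w1 \<in> carrier_vec N" "B *\<^sub>v w1 = x"
    and wint: "real k / real d * (y \<bullet> w1) \<in> \<int>"
    using circulant_block_diag_integral_pairing[OF k ns N(1) B_def x _ y _ v x_eq u y_eq] int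
    by (auto simp: x_def y_def)
  define a where "a = ones_vec N \<bullet> x"
  define b where "b = ones_vec N \<bullet> y"
  have B1: "B *\<^sub>v ones_vec N = real k \<cdot>\<^sub>v ones_vec N" "B\<^sup>T *\<^sub>v ones_vec N = real k \<cdot>\<^sub>v ones_vec N"
    using circulant_block_diag_ones[of ns k] ns N(1) by (auto simp: B_def)
  have "ones_vec N \<bullet> (B *\<^sub>v w1) = (B\<^sup>T *\<^sub>v ones_vec N) \<bullet> w1"
    by (rule transpose_vec_mult_scalar[OF B w1(1), symmetric]) simp
  then have sum_w1: "a = real k * (ones_vec N \<bullet> w1)"
    using w1 B1(2) by (simp add: a_def)
  \<comment> \<open>With \<open>w = \<alpha> 1 - w1\<close>, where 1 is the all-ones vector,
    \<open>M w = x\<close> holds once the entries of \<open>w\<close> sum to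
    \<open>\<alpha> k\<close>. They sum to \<open>\<alpha> N - a / k\<close>, which determines
    \<open>\<alpha>\<close>.\<close>
  define \<alpha> where "\<alpha> = a / (real k * real (N - k))"
  define w where "w = \<alpha> \<cdot>\<^sub>v ones_vec N - w1"
  have w: "w \<in> carrier_vec N" using w1(1) by (simp add: w_def)
  have Bw: "B *\<^sub>v w = (\<alpha> * real k) \<cdot>\<^sub>v ones_vec N - x"
    using B w1 B1(1) by (simp add: w_def mult_minus_distrib_mat_vec[OF B] mult_mat_vec[OF B] smult_smult_assoc)
  have "ones_vec N \<bullet> w = \<alpha> * real N - ones_vec N \<bullet> w1"
    using w1(1) by (simp add: w_def scalar_prod_minus_distrib[of _ N] scalar_prod_def sum_subtractf)
  moreover have "ones_vec N \<bullet> w1 = \<alpha> * (real N - real k)"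
    using k N(2) sum_w1 by (simp add: \<alpha>_def of_nat_diff)
  ultimately have "ones_vec N \<bullet> w = \<alpha> * real k" by (simp add: algebra_simps)
  then have Mw: "M *\<^sub>v w = x"
    using complement_mat_mult_vec[OF B w] M(1) Bw x
    by (intro eq_vecI) (auto simp: B_def[symmetric])
  have Yw: "Y *\<^sub>v w \<in> carrier_vec r" using Y w by simp
  \<comment> \<open>Both \<open>Y w\<close> and the unit vector are mapped to \<open>x\<close> by
    \<open>X\<close>, so injectivity identifies them; coordinate \<open>t\<close> then reads
    \<open>y \<bullet> w = 1\<close>.\<close>
  have "X *\<^sub>v (Y *\<^sub>v w - unit_vec r t) = 0\<^sub>v N"
  proof -
    have "X *\<^sub>v unit_vec r t = x"
      using X t by (intro eq_vecI) (auto simp: x_def)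
    then show ?thesis
      using mult_minus_distrib_mat_vec[OF X Yw, of "unit_vec r t"] Mw M(2) X Y w x by simp
  qed
  then have "Y *\<^sub>v w - unit_vec r t = 0\<^sub>v r" using injX Yw by simp
  then have "(Y *\<^sub>v w - unit_vec r t) $ t = 0" using t by simp
  then have "y \<bullet> w = 1" using t Y by (simp add: y_def)
  moreover have "y \<bullet> w = \<alpha> * b - y \<bullet> w1"
    using w1(1) y
    by (simp add: w_def b_def scalar_prod_minus_distrib[of _ N] comm_scalar_prod[of y N "ones_vec N"])
  \<comment> \<open>The left side equals \<open>a b / (d (N - k))\<close>, the quantity to be shown
    integral.\<close>
  ultimately have "real k / real d * (\<alpha> * b) = real k / real d + real k / real d * (y \<bullet> w1)"
    by (simp add: algebra_simps add_divide_distrib)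
  also have "\<dots> \<in> \<int>"
  proof -
    obtain e where "k = d * e" using k by blast
    then show ?thesis using k(1) wint by (intro Ints_add) auto
  qed
  finally show ?thesis
    using k(1) by (simp add: \<alpha>_def a_def b_def x_def y_def)
qed

text \<open>Entry \<open>(i, j)\<close> of the product counts the rectangles through that cell: one
  on the ones of \<open>A\<close>, none elsewhere. Parts of a partition are nonempty, which later
  makes all areas positive.\<close>

lemma rectangle_partition_factorization:
  assumes A: "A \<in> carrier_mat nr nc"
    and A01: "\<And>i j. i < nr \<Longrightarrow> j < nc \<Longrightarrow> A $$ (i, j) \<in> {0, 1}"
    and P: "finite P" "card P = r" "partition_on (ones_of A) P" "\<forall>S\<in>P. combinatorial_rectangle S"
  obtains R C where "A = mat nr r (\<lambda>(i, t). of_bool (i \<in> R t)) * mat r nc (\<lambda>(t, j). of_bool (j \<in> C t))"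
    "\<And>t. t < r \<Longrightarrow> \<exists>i<nr. i \<in> R t" "\<And>t. t < r \<Longrightarrow> \<exists>j<nc. j \<in> C t"
proof -
  obtain f where f: "bij_betw f {..<r} P"
    using P(1,2) ex_bij_betw_nat_finite[of P] by (auto simp: atLeast0LessThan)
  have "\<exists>R C. f t = R \<times> C" if "t < r" for t
    using that f P(4) by (auto simp: combinatorial_rectangle_def bij_betw_def)
  then obtain R C where RC: "\<And>t. t < r \<Longrightarrow> f t = R t \<times> C t" by metis
  have fP: "f t \<in> P" if "t < r" for t using f that by (auto simp: bij_betw_def)
  have UnP: "\<Union>P = ones_of A" and ne: "{} \<notin> P" and disj: "disjoint P"
    using P(3) by (auto simp: partition_on_def)
  have nonempty: "(\<exists>i<nr. i \<in> R t) \<and> (\<exists>j<nc. j \<in> C t)" if "t < r" for t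
  proof -
    have "f t \<noteq> {}" "f t \<subseteq> ones_of A" using fP[OF that] ne UnP by auto
    then obtain i j where "(i, j) \<in> f t" "(i, j) \<in> ones_of A" by auto
    then show ?thesis using RC[OF that] A by (auto simp: ones_of_def)
  qed
  have count: "(\<Sum>t<r. of_bool (i \<in> R t) * of_bool (j \<in> C t)) = A $$ (i, j)"
    if ij: "i < nr" "j < nc" for i j
  proof -
    have "(\<Sum>t<r. of_bool (i \<in> R t) * of_bool (j \<in> C t)) = (\<Sum>t<r. of_bool ((i, j) \<in> f t) :: real)"
      by (intro sum.cong) (auto simp: RC)
    also have "\<dots> = (\<Sum>S\<in>P. of_bool ((i, j) \<in> S))"
      by (rule sum.reindex_bij_betw[OF f])
    also have "\<dots> = A $$ (i, j)"
    proof (cases "(i, j) \<in> ones_of A")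
      case True
      then obtain S where S: "S \<in> P" "(i, j) \<in> S" using UnP by auto
      have "(i, j) \<notin> S'" if "S' \<in> P - {S}" for S'
        using disj S that by (auto simp: disjoint_def)
      then have "(\<Sum>S\<in>P - {S}. of_bool ((i, j) \<in> S) :: real) = 0" by simp
      then show ?thesis
        using sum.remove[OF P(1) S(1), of "\<lambda>S. of_bool ((i, j) \<in> S) :: real"] S(2) True
        by (simp add: ones_of_def)
    next
      case False
      then have "(\<Sum>S\<in>P. of_bool ((i, j) \<in> S) :: real) = 0" using UnP by (intro sum.neutral) auto
      then show ?thesis using False ij A A01[OF ij] by (auto simp: ones_of_def)
    qed
    finally show ?thesis .
  qed
  have "A = mat nr r (\<lambda>(i, t). of_bool (i \<in> R t)) * mat r nc (\<lambda>(t, j). of_bool (j \<in> C t))"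
    using A count by (intro eq_matI) (auto simp: scalar_prod_def atLeast0LessThan)
  then show thesis using that nonempty by blast
qed

text \<open>The partition into single cells shows that the minimum defining \<open>rank_bin\<close>
  is taken over a nonempty set.\<close>

lemma rank_bin_attained:
  obtains P where "finite P" "card P = rank_bin A" "partition_on (ones_of A) P"
    "\<forall>S\<in>P. combinatorial_rectangle S"
proof -
  let ?P = "(\<lambda>p. {p}) ` ones_of A"
  have "finite (ones_of A)"
    by (rule finite_subset[of _ "{..<dim_row A} \<times> {..<dim_col A}"]) (auto simp: ones_of_def)
  moreover have "partition_on (ones_of A) ?P"
    by (auto simp: partition_on_def disjoint_def)
  moreover have "\<forall>S\<in>?P. combinatorial_rectangle S"
  proof
    fix S assume "S \<in> ?P"
    then obtain i j where "S = {i} \<times> {j}" by auto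
    then show "combinatorial_rectangle S" unfolding combinatorial_rectangle_def by blast
  qed
  ultimately have "\<exists>r P. finite P \<and> card P = r \<and> partition_on (ones_of A) P \<and>
      (\<forall>S\<in>P. combinatorial_rectangle S)" by blast
  then have "\<exists>P. finite P \<and> card P = rank_bin A \<and> partition_on (ones_of A) P \<and>
      (\<forall>S\<in>P. combinatorial_rectangle S)"
    unfolding rank_bin_def by (rule LeastI_ex)
  then show thesis using that by blast
qed

text \<open>Both sides are the sum of all entries of \<open>X * Y\<close>. For indicator factors of
  a rectangle partition it says that the areas add up to the number of ones.\<close>

lemma sum_entries_product:
  fixes X Y :: "real mat"
  assumes X: "X \<in> carrier_mat n r" and Y: "Y \<in> carrier_mat r n'"
  shows "ones_vec n \<bullet> ((X * Y) *\<^sub>v ones_vec n')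
    = (\<Sum>t<r. (ones_vec n \<bullet> col X t) * (ones_vec n' \<bullet> row Y t))"
proof -
  have "ones_vec n \<bullet> ((X * Y) *\<^sub>v ones_vec n') = ones_vec n \<bullet> (X *\<^sub>v (Y *\<^sub>v ones_vec n'))"
    using X Y by simp
  also have "\<dots> = (X\<^sup>T *\<^sub>v ones_vec n) \<bullet> (Y *\<^sub>v ones_vec n')"
    using X Y by (intro transpose_vec_mult_scalar[of X n r, symmetric]) auto
  also have "\<dots> = (\<Sum>t<r. (col X t \<bullet> ones_vec n) * (row Y t \<bullet> ones_vec n'))"
    using X Y by (simp add: scalar_prod_def[of "X\<^sup>T *\<^sub>v ones_vec n"] atLeast0LessThan)
  also have "\<dots> = (\<Sum>t<r. (ones_vec n \<bullet> col X t) * (ones_vec n' \<bullet> row Y t))"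
    using X Y by (intro sum.cong) (auto simp: comm_scalar_prod[of _ n] comm_scalar_prod[of _ n'])
  finally show ?thesis .
qed

theorem theorem4p8:
  fixes m k n :: nat and ns :: "nat list" and M :: "real mat"
  assumes "m \<ge> 1" and "length ns = m"
    and "k > 0" and "\<forall>i<m. ns ! i \<ge> k"
    and "M = complement_mat (circulant_block_diag_mat k ns)"
    and "n = (\<Sum>i<m. ns ! i)"
    and "\<exists>d::nat. d > 1 \<and> (\<forall>i<m. d dvd gcd (ns ! i) k) \<and>
           real (rank_real M) > real n / real d"
  shows "rank_bin M \<ge> rank_real M + 1"
proof (rule ccontr)
  assume "\<not> rank_bin M \<ge> rank_real M + 1"
  then have le: "rank_bin M \<le> rank_real M" by simp
  define r where "r = rank_bin M"
  obtain d where d: "d > 1" "\<forall>i<m. d dvd gcd (ns ! i) k"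
    and rank: "real (rank_real M) > real n / real d"
    using assms(7) by blast
  have n: "n = sum_list ns"
    using assms(2,6) by (simp add: sum_list_sum_nth atLeast0LessThan)
  have ns: "\<forall>l\<in>set ns. k \<le> l \<and> d dvd l"
    using assms(2,4) d(2) by (auto simp: in_set_conv_nth)
  have dk: "d dvd k" using d(2)[rule_format, of 0] assms(1) by simp
  have "ns ! 0 \<in> set ns" using assms(1,2) by (intro nth_mem) simp
  then have kn: "k \<le> n" using ns member_le_sum_list[of "ns ! 0" ns] n by fastforce
  define B where "B = circulant_block_diag_mat k ns"
  have B: "B \<in> carrier_mat n n" using n circulant_block_diag_carrier by (simp add: B_def)
  have M: "M \<in> carrier_mat n n" "M = complement_mat B" using assms(5) B by (auto simp: B_def)
  have M01: "M $$ (i, j) \<in> {0, 1}" if "i < n" "j < n" for i j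
    using circulant_block_diag_01[of ns k i j] ns that n M(2) B
    by (auto simp: complement_mat_def B_def)
  obtain P where P: "finite P" "card P = r" "partition_on (ones_of M) P"
    "\<forall>S\<in>P. combinatorial_rectangle S"
    unfolding r_def by (rule rank_bin_attained)
  obtain R C where RC: "M = mat n r (\<lambda>(i, t). of_bool (i \<in> R t)) * mat r n (\<lambda>(t, j). of_bool (j \<in> C t))"
    and R: "\<And>t. t < r \<Longrightarrow> \<exists>i<n. i \<in> R t" and C: "\<And>t. t < r \<Longrightarrow> \<exists>j<n. j \<in> C t"
    using rectangle_partition_factorization[OF M(1) M01 P] by metis
  define X :: "real mat" where "X = mat n r (\<lambda>(i, t). of_bool (i \<in> R t))"
  define Y :: "real mat" where "Y = mat r n (\<lambda>(t, j). of_bool (j \<in> C t))"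
  have X: "X \<in> carrier_mat n r" and Y: "Y \<in> carrier_mat r n" and MXY: "M = X * Y"
    using RC by (auto simp: X_def Y_def)
  have rM: "vec_space.rank n M = rank_real M" using M(1) by (simp add: rank_real_def)
  \<comment> \<open>The contradiction hypothesis gives this inequality and the factorization through
    \<open>r\<close> gives the reverse one, so \<open>M = X * Y\<close> is a rank
    factorization.\<close>
  have "r \<le> vec_space.rank n M" using le rM by (simp add: r_def)
  have "rank_real M \<le> r" using rank_mult_le_inner_dim[OF X Y] MXY rM by simp
  define area where "area t = (ones_vec n \<bullet> col X t) * (ones_vec n \<bullet> row Y t)" for t
  have area_pos: "area t > 0" if t: "t < r" for t
  proof -
    have "ones_vec n \<bullet> col X t > 0"
      using R[OF t] t by (auto simp: X_def scalar_prod_def card_gt_0_iff)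
    moreover have "ones_vec n \<bullet> row Y t > 0"
      using C[OF t] t by (auto simp: Y_def scalar_prod_def card_gt_0_iff)
    ultimately show ?thesis by (simp add: area_def)
  qed
  have "M *\<^sub>v ones_vec n = (real n - real k) \<cdot>\<^sub>v ones_vec n"
    using complement_mat_mult_vec[OF B, of "ones_vec n"] circulant_block_diag_ones[of ns k] ns n M(2)
    by (intro eq_vecI) (auto simp: B_def scalar_prod_def)
  then have total: "(\<Sum>t<r. area t) = real n * (real n - real k)"
    using sum_entries_product[OF X Y] MXY by (simp add: area_def scalar_prod_def)
  show False
  proof (cases "k = n")
    case True
    have "r = 0"
    proof (rule ccontr)
      assume "r \<noteq> 0"
      then have "(\<Sum>t<r. area t) > 0" using area_pos by (intro sum_pos) auto
      then show False using total True by simp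
    qed
    then show False using \<open>rank_real M \<le> r\<close> rank by (simp add: divide_less_0_iff)
  next
    case False
    then have kn: "k < n" using kn by simp
    \<comment> \<open>The area is a positive integral multiple of \<open>d * (n - k)\<close>, hence
      at least that large.\<close>
    have "area t \<ge> real d * real (n - k)" if t: "t < r" for t
    proof -
      have "int_vec (col X t)" "int_vec (row Y t)"
        using t by (auto simp: int_vec_def X_def Y_def)
      then have "area t / (real d * real (n - k)) \<in> \<int>"
        unfolding area_def
        using tight_factor_integrality[OF assms(3) dk ns n kn assms(5) MXY X Y _ t]
          \<open>r \<le> vec_space.rank n M\<close> by blast
      then obtain z :: int where z: "area t / (real d * real (n - k)) = of_int z"
        by (auto elim: Ints_cases)
      have pos: "real d * real (n - k) > 0" using d(1) kn by simp
      then have "of_int z > (0 :: real)" using area_pos[OF t] z by (metis divide_pos_pos)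
      then have "of_int z \<ge> (1 :: real)" by simp
      then have "1 \<le> area t / (real d * real (n - k))" using z by simp
      then show ?thesis using pos by (simp only: le_divide_eq_1_pos)
    qed
    then have "(\<Sum>t<r. real d * real (n - k)) \<le> (\<Sum>t<r. area t)" by (intro sum_mono) auto
    then have "real r * real d * real (n - k) \<le> real n * real (n - k)"
      using total kn by (simp add: of_nat_diff)
    then have "real r * real d \<le> real n" using kn by simp
    moreover have "real r > real n / real d"
      using rank \<open>rank_real M \<le> r\<close> by linarith
    ultimately show False using d(1) by (simp add: field_simps)
  qed
qed

end
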